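(* Let $f_1,f_2:\mathbb{R}\to\mathbb{R}$ be known signals (in particular, their Fourier transforms are known), and let $$F(x)=\sum_{j=1}^{2}\sum_{q=1}^{N}a_{jq}\,f_j(x-x_{jq}),\qquad a_{jq}\in\mathbb{R},\ x_{jq}\in\mathbb{R}.$$ Let $W_1$ be the set of real zeroes of $\mathcal{F}(f_2)$ which are not zeroes of $\mathcal{F}(f_1)$, and let $W_2$ be the set of real zeroes of $\mathcal{F}(f_1)$ which are not zeroes of $\mathcal{F}(f_2)$. Assume that each of the sets $W_1$ and $W_2$ contains at least $2N$ elements. Let $D_j$, $j=1,2$, be the length of the shortest interval $\Delta_j$ such that $S_j=\Delta_j\cap W_j$ contains exactly $2N$ elements, and let $\rho_j=1/D_j$. Then for shifts $x_{jq}$ in the interval $[0,\rho_j)$, $j=1,2$, the systems $$\sum_{q=1}^{N}a_{jq}\,y_{jq}^{s}=\frac{\mathcal{F}(F)(s)}{\mathcal{F}(f_j)(s)},\qquad s\in S_j,\qquad j=1,2,$$ with the sampling sets $S_1,S_2$ are uniquely solvable.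
   Context: The Fourier transform is $\mathcal{F}(g)(s)=\int_{\mathbb{R}}e^{-2\pi i s x}g(x)\,dx$. Here $y_{jq}=e^{-2\pi i x_{jq}}$, and $y_{jq}^{s}$ denotes $e^{-2\pi i x_{jq}s}$ for real $s$. The unknowns of the systems are the amplitudes $a_{jq}$ and the shifts $x_{jq}$ (encoded in $y_{jq}$), to be found from the samples of $\mathcal{F}(F)$ at the points of $S_1$ and $S_2$.
   Formalization: Unique solvability means: the combination of shifts weighted by amplitudes is unique, and amplitudes and shifts are unique up to renumbering if some solution has non-zero amplitudes and distinct shifts (with a zero amplitude the shift is arbitrary); N ≥ 1 and existence of a shortest interval are assumed. *)

theory Defs
  imports "HOL-Analysis.Analysis"
begin

definition fourier :: "(real \<Rightarrow> real) \<Rightarrow> real \<Rightarrow> complex" where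
  "fourier g s = (LINT x|lebesgue. exp (- 2 * pi * \<i> * s * x) * complex_of_real (g x))"

(* ypow x s is y^s for the node y = e^(-2 pi i x); it depends on the shift x itself and not
   only on y, since s is an arbitrary real number. *)
definition ypow :: "real \<Rightarrow> real \<Rightarrow> complex" where
  "ypow x s = exp (- 2 * pi * \<i> * x * s)"

(* Signals are indexed by j = 1, 2, so 3 - j is the index of the other signal. *)
definition W :: "(nat \<Rightarrow> real \<Rightarrow> real) \<Rightarrow> nat \<Rightarrow> real set" where
  "W f j = {s. fourier (f (3 - j)) s = 0 \<and> fourier (f j) s \<noteq> 0}"

definition has_at_least :: "real set \<Rightarrow> nat \<Rightarrow> bool" where
  "has_at_least A m \<longleftrightarrow> infinite A \<or> card A \<ge> m"

definition has_exactly :: "real set \<Rightarrow> nat \<Rightarrow> bool" where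
  "has_exactly A m \<longleftrightarrow> finite A \<and> card A = m"

(* Intervals may be open, closed or half-open. Boundedness is required explicitly because
   measure (unlike emeasure) assigns the value 0 to an unbounded interval. *)
definition bounded_interval :: "real set \<Rightarrow> bool" where
  "bounded_interval I \<longleftrightarrow> is_interval I \<and> bounded I"

definition shortest_interval :: "real set \<Rightarrow> nat \<Rightarrow> real set \<Rightarrow> bool" where
  "shortest_interval A m I \<longleftrightarrow>
     bounded_interval I \<and> has_exactly (I \<inter> A) m \<and>
     (\<forall>J. bounded_interval J \<and> has_exactly (J \<inter> A) m \<longrightarrow> measure lborel I \<le> measure lborel J)"

definition system_solution ::
  "nat \<Rightarrow> real set \<Rightarrow> (real \<Rightarrow> complex) \<Rightarrow> real \<Rightarrow> (nat \<Rightarrow> real) \<Rightarrow> (nat \<Rightarrow> real) \<Rightarrow> bool" where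
  "system_solution N S R \<rho> a x \<longleftrightarrow>
     (\<forall>q\<in>{1..N}. x q \<in> {0..<\<rho>}) \<and>
     (\<forall>s\<in>S. (\<Sum>q=1..N. a q * ypow (x q) s) = R s)"

definition nondegenerate :: "nat \<Rightarrow> (nat \<Rightarrow> real) \<Rightarrow> (nat \<Rightarrow> real) \<Rightarrow> bool" where
  "nondegenerate N a x \<longleftrightarrow> (\<forall>q\<in>{1..N}. a q \<noteq> 0) \<and> inj_on x {1..N}"

(* (a, x) and (a', x') describe the same combination of point masses sum_q a_q delta_(x_q). *)
definition same_combination ::
  "nat \<Rightarrow> (nat \<Rightarrow> real) \<Rightarrow> (nat \<Rightarrow> real) \<Rightarrow> (nat \<Rightarrow> real) \<Rightarrow> (nat \<Rightarrow> real) \<Rightarrow> bool" where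
  "same_combination N a x a' x' \<longleftrightarrow>
     (\<forall>t. (\<Sum>q\<in>{q\<in>{1..N}. x q = t}. a q) = (\<Sum>q\<in>{q\<in>{1..N}. x' q = t}. a' q))"

definition same_up_to_order ::
  "nat \<Rightarrow> (nat \<Rightarrow> real) \<Rightarrow> (nat \<Rightarrow> real) \<Rightarrow> (nat \<Rightarrow> real) \<Rightarrow> (nat \<Rightarrow> real) \<Rightarrow> bool" where
  "same_up_to_order N a x a' x' \<longleftrightarrow>
     (\<exists>p. bij_betw p {1..N} {1..N} \<and> (\<forall>q\<in>{1..N}. a' q = a (p q) \<and> x' q = x (p q)))"

(* Literal uniqueness of the unknowns fails: the N terms can be renumbered, the shift of a term
   with zero amplitude is arbitrary, and terms with equal shifts can be redistributed.
   A nondegenerate solution is unique up to renumbering among all solutions; in general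
   zero terms and coinciding shifts are the only further freedom. *)
definition uniquely_solvable :: "nat \<Rightarrow> real set \<Rightarrow> (real \<Rightarrow> complex) \<Rightarrow> real \<Rightarrow> bool" where
  "uniquely_solvable N S R \<rho> \<longleftrightarrow>
     (\<exists>a x. system_solution N S R \<rho> a x) \<and>
     (\<forall>a x a' x'. system_solution N S R \<rho> a x \<and> system_solution N S R \<rho> a' x' \<longrightarrow>
        same_combination N a x a' x' \<and>
        (nondegenerate N a x \<longrightarrow> same_up_to_order N a x a' x'))"

end

(* By linearity and the shift rule, F(F)(s) splits into the two signals, and at the points of W_j
   only the j-th one survives; this is the solvability of the systems.
   For uniqueness, the difference of two solutions is an exponential sum with m <= 2N distinct
   frequencies that vanishes at 2N points of an interval of length D_j, while the frequencies
   -2 pi x spread over less than 2 pi / D_j. By a theorem of Langer, such a sum has at most m - 1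
   zeros there, so all its coefficients vanish. For Langer's bound, apply the argument principle
   to a tall rectangle around the zeros. On the far horizontal sides one extreme frequency
   dominates, and together they contribute (frequency spread) * (width) < 2 pi. On a vertical
   side the sum becomes a combination of m real exponentials with complex coefficients; its
   argument varies by at most pi (m - 1), since otherwise some line through 0 would be met m times,
   which gives a real exponential sum with m terms and m zeros. *)

theory Submission
  imports Defs "HOL-Complex_Analysis.Complex_Analysis"
begin

section \<open>Zeros of real exponential sums\<close>

text \<open>Every point of \<open>Z\<close> except the largest has a successor in \<open>Z\<close>;
  the gaps between neighbours are disjoint, and Rolle's theorem puts a zero of \<open>h'\<close>
  into each.\<close>

lemma Rolle_finite_zero_set:
  fixes h h' :: "real \<Rightarrow> real"
  assumes "finite Z" and zero: "\<And>z. z \<in> Z \<Longrightarrow> h z = 0"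
    and der: "\<And>t. (h has_real_derivative h' t) (at t)"
  obtains Z' where "finite Z'" "card Z' = card Z - 1" "\<And>t. t \<in> Z' \<Longrightarrow> h' t = 0"
proof (cases "Z = {}")
  case True
  then show ?thesis using that[of "{}"] by simp
next
  case False
  define Y where "Y = Z - {Max Z}"
  define nxt where "nxt z = Min {w\<in>Z. w > z}" for z
  have nxt: "nxt z \<in> Z" "z < nxt z" "\<And>w. w \<in> Z \<Longrightarrow> z < w \<Longrightarrow> nxt z \<le> w" if "z \<in> Y" for z
  proof -
    have "Max Z \<in> {w\<in>Z. w > z}"
      using that \<open>finite Z\<close> False by (auto simp: Y_def order_less_le)
    then have "nxt z \<in> {w\<in>Z. w > z}"
      unfolding nxt_def using \<open>finite Z\<close> by (intro Min_in) auto
    then show "nxt z \<in> Z" "z < nxt z" by auto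
    show "nxt z \<le> w" if "w \<in> Z" "z < w" for w
      unfolding nxt_def using that \<open>finite Z\<close> by (intro Min_le) auto
  qed
  have "\<exists>t. z < t \<and> t < nxt z \<and> h' t = 0" if "z \<in> Y" for z
  proof -
    have "\<exists>t>z. t < nxt z \<and> (h has_real_derivative 0) (at t)"
    proof (rule Rolle)
      show "z < nxt z" "h z = h (nxt z)"
        using nxt[OF that] zero that by (auto simp: Y_def)
      show "continuous_on {z..nxt z} h"
        using der by (intro continuous_at_imp_continuous_on) (auto intro: DERIV_isCont)
      show "h differentiable at t" for t
        using der real_differentiable_def by blast
    qed
    then show ?thesis using der DERIV_unique by blast
  qed
  then obtain r where r: "\<And>z. z \<in> Y \<Longrightarrow> z < r z \<and> r z < nxt z \<and> h' (r z) = 0"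
    by metis
  have "r y < r z" if "y \<in> Y" "z \<in> Y" "y < z" for y z
    using r[OF that(1)] r[OF that(2)] nxt(3)[OF that(1), of z] that by (auto simp: Y_def)
  then have "inj_on r Y"
    by (metis inj_onI less_irrefl linorder_less_linear)
  then have "card (r ` Y) = card Z - 1"
    using \<open>finite Z\<close> False by (simp add: card_image Y_def)
  then show ?thesis
    using that[of "r ` Y"] r \<open>finite Z\<close> by (auto simp: Y_def)
qed

text \<open>Induction on the number of exponents: after division by one exponential its term is
  constant and differentiation removes it, at the cost of one zero by Rolle. One term and one zero
  fewer keep the hypothesis intact.\<close>

lemma real_exponential_sum_zero:
  fixes b :: "real \<Rightarrow> real"
  assumes "finite K" "finite Z" "card K \<le> card Z"
    and "\<And>t. t \<in> Z \<Longrightarrow> (\<Sum>l\<in>K. b l * exp (l * t)) = 0"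
  shows "\<forall>l\<in>K. b l = 0"
  using assms
proof (induction K arbitrary: b Z rule: finite_induct)
  case empty
  then show ?case by simp
next
  case (insert m K)
  define h where "h t = b m + (\<Sum>l\<in>K. b l * exp ((l - m) * t))" for t
  define h' where "h' t = (\<Sum>l\<in>K. b l * (l - m) * exp ((l - m) * t))" for t
  have h: "h t = exp (- m * t) * (\<Sum>l\<in>insert m K. b l * exp (l * t))" for t
    using insert.hyps
    by (simp add: h_def algebra_simps sum_distrib_left flip: exp_add)
  have "(h has_real_derivative h' t) (at t)" for t
    unfolding h_def h'_def by (auto intro!: derivative_eq_intros sum.cong simp: mult_ac)
  then obtain Z' where Z': "finite Z'" "card Z' = card Z - 1" "\<And>t. t \<in> Z' \<Longrightarrow> h' t = 0"
    using Rolle_finite_zero_set[of Z h h'] insert.prems h by auto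
  have "(\<Sum>l\<in>K. b l * (l - m) * exp (l * t)) = 0" if "t \<in> Z'" for t
  proof -
    have "(\<Sum>l\<in>K. b l * (l - m) * exp (l * t)) = exp (m * t) * h' t"
      by (simp add: h'_def sum_distrib_left algebra_simps flip: exp_add)
    then show ?thesis using Z'(3)[OF that] by simp
  qed
  moreover have "card K \<le> card Z'"
    using insert.prems insert.hyps Z' by simp
  ultimately have "\<forall>l\<in>K. b l * (l - m) = 0"
    using insert.IH[of Z' "\<lambda>l. b l * (l - m)"] Z' by blast
  \<comment> \<open>The factors \<open>l - m\<close> produced by differentiation are nonzero because
    \<open>m\<close> is not in \<open>K\<close>.\<close>
  then have K: "\<forall>l\<in>K. b l = 0"
    using insert.hyps by auto
  have "card Z > 0" using insert.prems insert.hyps by simp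
  then obtain t where "t \<in> Z" by (metis card.empty equals0I less_irrefl)
  then have "h t = 0" using h insert.prems by simp
  then have "b m = 0" using K by (simp add: h_def)
  then show ?case using K by simp
qed

section \<open>Variation of the argument along a vertical segment\<close>

text \<open>Up to an additive constant, \<open>\<psi>\<close> is a continuous logarithm of
  \<open>G\<close>. If the argument moved further, \<open>G\<close> would meet some line through 0
  at \<open>card K\<close> times without starting on it. The component of \<open>G\<close> normal to
  that line is a real exponential sum, which so many zeros force to vanish identically, even at time
  0.\<close>

lemma arg_change_real_exponents:
  fixes K :: "real set" and C :: "real \<Rightarrow> complex" and k :: real and \<psi> :: "real \<Rightarrow> complex"
  defines "G \<equiv> \<lambda>t. \<Sum>l\<in>K. C l * exp (of_real (l * (k * t)))"
  assumes "finite K" "k \<noteq> 0"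
    and nz: "\<And>t. t \<in> {0..1} \<Longrightarrow> G t \<noteq> 0"
    and dG: "\<And>t. t \<in> {0..1} \<Longrightarrow> (G has_vector_derivative G' t) (at t within {0..1})"
    and d\<psi>: "\<And>t. t \<in> {0..1} \<Longrightarrow> (\<psi> has_vector_derivative G' t / G t) (at t within {0..1})"
  shows "\<bar>Im (\<psi> 1 - \<psi> 0)\<bar> \<le> pi * (real (card K) - 1)"
proof (rule ccontr)
  assume contra: "\<not> ?thesis"
  have "K \<noteq> {}" using nz[of 0] by (auto simp: G_def)
  then have "card K \<ge> 1" using \<open>finite K\<close> by (simp add: Suc_leI card_gt_0_iff)
  define A where "A = Im (\<psi> 1 - \<psi> 0)"
  \<comment> \<open>The sign of the total change normalises the direction of rotation, so that
    \<open>\<phi>\<close> goes from 0 to \<open>\<bar>A\<bar>\<close>.\<close>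
  define \<sigma> where "\<sigma> = sgn A"
  have A: "\<bar>A\<bar> > pi * (real (card K) - 1)" using contra by (simp add: A_def)
  then have "A \<noteq> 0" using \<open>card K \<ge> 1\<close> by (auto simp: mult_less_0_iff)
  then have \<sigma>: "\<sigma> * \<sigma> = 1" "\<sigma> * A = \<bar>A\<bar>" "\<sigma> = 1 \<or> \<sigma> = -1" by (auto simp: \<sigma>_def sgn_if)
  define \<phi> where "\<phi> t = \<sigma> * Im (\<psi> t - \<psi> 0)" for t
  have \<phi>: "\<phi> 0 = 0" "\<phi> 1 = \<bar>A\<bar>"
    using \<sigma>(2) unfolding \<phi>_def A_def by simp_all
  have cont\<psi>: "continuous_on {0..1} \<psi>"
    using d\<psi> by (intro continuous_on_vector_derivative)
  have cont: "continuous_on {0..1} \<phi>"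
    unfolding \<phi>_def by (intro continuous_intros cont\<psi>)
  \<comment> \<open>The product \<open>G t * exp (- \<psi> t)\<close> has derivative zero, hence is
    constant.\<close>
  have Gexp: "G t = G 0 * exp (\<psi> t - \<psi> 0)" if "t \<in> {0..1}" for t
  proof -
    have "((\<lambda>t. G t * exp (- \<psi> t)) has_vector_derivative 0) (at t within {0..1})" if "t \<in> {0..1}" for t
    proof -
      have "((\<lambda>t. exp (- \<psi> t)) has_vector_derivative (- (G' t / G t) * exp (- \<psi> t))) (at t within {0..1})"
        using field_vector_diff_chain_within[OF has_vector_derivative_minus[OF d\<psi>[OF that]],
          of exp "exp (- \<psi> t)"]
        by (simp add: o_def DERIV_subset[OF DERIV_exp] has_field_derivative_at_within)
      from has_vector_derivative_mult[OF dG[OF that] this]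
      show ?thesis using nz[OF that] by (simp add: field_simps)
    qed
    then obtain c where "\<And>t. t \<in> {0..1} \<Longrightarrow> G t * exp (- \<psi> t) = c"
      using has_derivative_zero_constant[of "{0..1::real}" "\<lambda>t. G t * exp (- \<psi> t)"]
      by (auto simp: has_vector_derivative_def)
    from this[OF that] this[of 0] have "G t * exp (- \<psi> t) = G 0 * exp (- \<psi> 0)" by simp
    then show ?thesis by (simp add: exp_minus exp_diff field_simps)
  qed
  \<comment> \<open>An offset strictly between 0 and pi keeps the starting direction off the line;
    it is also small enough that all levels \<open>\<delta> + pi * j\<close> with
    \<open>j < card K\<close> lie between 0 and \<open>\<bar>A\<bar>\<close>.\<close>
  define \<delta> where "\<delta> = min (pi / 2) ((\<bar>A\<bar> - pi * (real (card K) - 1)) / 2)"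
  have \<delta>: "0 < \<delta>" "\<delta> < pi" "\<delta> + pi * (real (card K) - 1) < \<bar>A\<bar>"
    using A pi_gt_zero by (auto simp: \<delta>_def min_def field_simps)
  have "\<exists>t\<in>{0..1}. \<phi> t = \<delta> + pi * j" if "j < card K" for j :: nat
  proof -
    have "pi * j \<le> pi * (real (card K) - 1)" using that by (intro mult_left_mono) auto
    moreover have "0 \<le> pi * j" by simp
    ultimately have "\<phi> 0 \<le> \<delta> + pi * j" "\<delta> + pi * j \<le> \<phi> 1"
      using \<delta> \<phi> by linarith+
    then show ?thesis using IVT'[OF _ _ _ cont] by fastforce
  qed
  then obtain \<tau> where \<tau>: "\<And>j. j < card K \<Longrightarrow> \<tau> j \<in> {0..1} \<and> \<phi> (\<tau> j) = \<delta> + pi * real j"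
    by metis
  have inj: "inj_on \<tau> {..<card K}"
  proof (rule inj_onI)
    fix i j assume "i \<in> {..<card K}" "j \<in> {..<card K}" "\<tau> i = \<tau> j"
    moreover from this have "\<phi> (\<tau> i) = \<delta> + pi * real i" "\<phi> (\<tau> j) = \<delta> + pi * real j"
      using \<tau> by blast+
    ultimately have "\<delta> + pi * real i = \<delta> + pi * real j" by metis
    then have "pi * real i = pi * real j" by (rule add_left_imp_eq)
    then show "i = j" by simp
  qed
  \<comment> \<open>Multiplication by \<omega> turns the line through 0 that the curve meets at the times \<tau> j
    into the imaginary axis; the starting point G 0 does not lie on that line.\<close>
  define \<omega> where "\<omega> = \<i> * exp (- \<i> * \<sigma> * \<delta>) / G 0"
  define b where "b l = Re (\<omega> * C l)" for l
  have b: "(\<Sum>l\<in>K. b l * exp (l * (k * t))) = Re (\<omega> * G t)" for t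
    by (simp add: b_def G_def sum_distrib_left mult.assoc[symmetric] exp_of_real
        del: of_real_mult)
  have "Re (\<omega> * G (\<tau> j)) = 0" if "j < card K" for j
  proof -
    let ?t = "\<tau> j"
    have "Im (\<psi> ?t - \<psi> 0) = \<sigma> * \<phi> ?t"
      using \<sigma> by (simp add: \<phi>_def mult.assoc[symmetric])
    then have im: "Im (\<psi> ?t - \<psi> 0) = \<sigma> * \<delta> + \<sigma> * (pi * j)"
      using \<tau>[OF that] by (simp add: algebra_simps)
    have "\<omega> * G ?t = \<i> * exp (\<psi> ?t - \<psi> 0 - \<i> * \<sigma> * \<delta>)"
    proof -
      have "exp (\<psi> ?t - \<psi> 0 - \<i> * \<sigma> * \<delta>) = exp (\<psi> ?t - \<psi> 0) * exp (- \<i> * \<sigma> * \<delta>)"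
        by (simp flip: exp_add)
      moreover have "G ?t = G 0 * exp (\<psi> ?t - \<psi> 0)" using Gexp \<tau>[OF that] by blast
      ultimately show ?thesis using nz[of 0] by (simp add: \<omega>_def)
    qed
    then have "Re (\<omega> * G ?t) = - Im (exp (\<psi> ?t - \<psi> 0 - \<i> * \<sigma> * \<delta>))" by simp
    also have "\<dots> = - (exp (Re (\<psi> ?t - \<psi> 0)) * sin (\<sigma> * (pi * j)))"
      using im by (simp add: Im_exp)
    also have "sin (\<sigma> * (pi * j)) = 0"
      using \<sigma>(3) by auto
    finally show ?thesis by simp
  qed
  then have "\<And>t. t \<in> (\<lambda>j. k * \<tau> j) ` {..<card K} \<Longrightarrow> (\<Sum>l\<in>K. b l * exp (l * t)) = 0"
    using b by auto
  moreover have "card ((\<lambda>j. k * \<tau> j) ` {..<card K}) = card K"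
    using inj \<open>k \<noteq> 0\<close> by (subst card_image) (auto simp: inj_on_def)
  ultimately have "\<forall>l\<in>K. b l = 0"
    by (intro real_exponential_sum_zero[OF \<open>finite K\<close>, of "(\<lambda>j. k * \<tau> j) ` {..<card K}"]) auto
  then have "Re (\<omega> * G 0) = 0" using b[of 0] by simp
  moreover have "Re (\<omega> * G 0) = \<sigma> * sin \<delta>"
    using nz[of 0] \<sigma>(3) by (auto simp: \<omega>_def Im_exp)
  ultimately show False using \<delta> sin_gt_zero[of \<delta>] \<sigma>(3) by auto
qed

section \<open>Exponential sums in the complex plane\<close>

text \<open>The frequencies themselves are the indices, so they are distinct by construction and
  \<open>card K\<close> is the number of terms.\<close>

definition exp_sum :: "real set \<Rightarrow> (real \<Rightarrow> complex) \<Rightarrow> complex \<Rightarrow> complex" where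
  "exp_sum K c z = (\<Sum>l\<in>K. c l * exp (\<i> * l * z))"

lemma has_field_derivative_exp_sum:
  "(exp_sum K c has_field_derivative exp_sum K (\<lambda>l. \<i> * l * c l) z) (at z within S)"
  unfolding exp_sum_def[abs_def] by (auto intro!: derivative_eq_intros sum.cong simp: mult_ac)

lemma deriv_exp_sum: "deriv (exp_sum K c) z = exp_sum K (\<lambda>l. \<i> * l * c l) z"
  by (rule DERIV_imp_deriv[OF has_field_derivative_exp_sum])

lemma holomorphic_exp_sum [holomorphic_intros]: "exp_sum K c holomorphic_on S"
  by (metis has_field_derivative_exp_sum field_differentiable_def holomorphic_on_def)

lemma continuous_on_exp_sum [continuous_intros]: "continuous_on S (exp_sum K c)"
  by (rule holomorphic_on_imp_continuous_on[OF holomorphic_exp_sum])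

lemma continuous_on_log_deriv_exp_sum:
  assumes "\<And>z. z \<in> S \<Longrightarrow> exp_sum K c z \<noteq> 0"
  shows "continuous_on S (\<lambda>z. deriv (exp_sum K c) z / exp_sum K c z)"
  unfolding deriv_exp_sum by (intro continuous_intros) (use assms in auto)

text \<open>Along a vertical segment \<open>\<i> * (v - u)\<close> is real, so each term is a
  complex constant times a real exponential of the path parameter.\<close>

lemma exp_sum_arg_change_vertical:
  assumes "finite K" "Re u = Re v" "u \<noteq> v"
    and nz: "\<And>z. z \<in> closed_segment u v \<Longrightarrow> exp_sum K c z \<noteq> 0"
  shows "\<bar>Im (contour_integral (linepath u v) (\<lambda>z. deriv (exp_sum K c) z / exp_sum K c z))\<bar>
           \<le> pi * (real (card K) - 1)"
proof -
  let ?g = "exp_sum K c"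
  define k where "k = Im u - Im v"
  have k: "\<i> * (v - u) = of_real k" "k \<noteq> 0"
    using assms by (auto simp: k_def complex_eq_iff)
  define q where "q t = (deriv ?g (linepath u v t) / ?g (linepath u v t)) * (v - u)" for t
  \<comment> \<open>The partial contour integral of the logarithmic derivative serves as the
    logarithm; its total increment is the full contour integral.\<close>
  define \<psi> where "\<psi> t = integral {0..t} q" for t
  define G where "G t = (\<Sum>l\<in>K. (c l * exp (\<i> * l * u)) * exp (of_real (l * (k * t))))" for t
  have G: "G t = ?g (linepath u v t)" for t
    unfolding G_def exp_sum_def of_real_mult k(1)[symmetric]
    by (intro sum.cong refl)
      (simp add: linepath_def scaleR_conv_of_real algebra_simps flip: exp_add)
  have seg: "linepath u v t \<in> closed_segment u v" if "t \<in> {0..1}" for t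
    using that by (metis imageI linepath_image_01)
  have dline: "(linepath u v has_vector_derivative (v - u)) (at t within {0..1})" for t
    by (rule has_vector_derivative_linepath_within)
  have contq: "continuous_on {0..1} q"
  proof -
    have "continuous_on {0..1} (\<lambda>t. deriv ?g (linepath u v t) / ?g (linepath u v t))"
      by (rule continuous_on_compose2[OF continuous_on_log_deriv_exp_sum[OF nz] continuous_on_linepath])
        (use seg in blast)+
    then show ?thesis unfolding q_def by (rule continuous_on_mult_right)
  qed
  have "\<bar>Im (\<psi> 1 - \<psi> 0)\<bar> \<le> pi * (real (card K) - 1)"
  proof (rule arg_change_real_exponents[OF \<open>finite K\<close> \<open>k \<noteq> 0\<close>, where C = "\<lambda>l. c l * exp (\<i> * l * u)"
        and G' = "\<lambda>t. deriv ?g (linepath u v t) * (v - u)", folded G_def])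
    fix t :: real assume t: "t \<in> {0..1}"
    show "G t \<noteq> 0" using G nz seg t by simp
    have "((?g \<circ> linepath u v) has_vector_derivative (v - u) * deriv ?g (linepath u v t)) (at t within {0..1})"
      unfolding deriv_exp_sum
      by (rule field_vector_diff_chain_within[OF dline has_field_derivative_exp_sum])
    then show "(G has_vector_derivative deriv ?g (linepath u v t) * (v - u)) (at t within {0..1})"
      by (simp add: G o_def mult.commute G[abs_def])
    show "(\<psi> has_vector_derivative deriv ?g (linepath u v t) * (v - u) / G t) (at t within {0..1})"
      using integral_has_vector_derivative[OF contq t] by (simp add: \<psi>_def[abs_def] q_def G)
  qed
  moreover have "contour_integral (linepath u v) (\<lambda>z. deriv ?g z / ?g z) = \<psi> 1 - \<psi> 0"
    by (simp add: contour_integral_integral \<psi>_def q_def[abs_def] vector_derivative_linepath_at)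
  ultimately show ?thesis by simp
qed

lemma tendsto_exp_neg_mult_at_top:
  fixes k :: real
  assumes "k > 0"
  shows "((\<lambda>t. exp (- k * t)) \<longlongrightarrow> 0) at_top"
proof (rule filterlim_compose[OF exp_at_bot])
  show "filterlim (\<lambda>t. - k * t) at_bot at_top"
    using assms by (intro filterlim_tendsto_neg_mult_at_bot[OF tendsto_const]) (auto simp: filterlim_ident)
qed

text \<open>After \<open>exp (\<i> * m * z)\<close> is factored out, the remaining terms decay like
  \<open>exp (- \<bar>l - m\<bar> * T)\<close>, uniformly in the real part of \<open>z\<close>. The
  case \<open>\<sigma> = 1\<close> concerns the upper half-plane with \<open>m\<close> the smallest
  frequency, \<open>\<sigma> = -1\<close> the lower one with \<open>m\<close> the largest.\<close>

lemma exp_sum_log_deriv_limit: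
  fixes \<sigma> \<epsilon> :: real
  assumes "finite K" "m \<in> K" "c m \<noteq> 0" "\<epsilon> > 0" and \<sigma>: "\<sigma> = 1 \<or> \<sigma> = -1"
    and pos: "\<And>l. l \<in> K - {m} \<Longrightarrow> \<sigma> * (l - m) > 0"
  shows "\<forall>\<^sub>F T in at_top. \<forall>z. \<sigma> * Im z = T \<longrightarrow> exp_sum K c z \<noteq> 0 \<and>
           norm (deriv (exp_sum K c) z / exp_sum K c z - \<i> * m) \<le> \<epsilon>"
proof -
  define R where "R = K - {m}"
  define A where "A t = (\<Sum>l\<in>R. norm (c l) * exp (- \<bar>l - m\<bar> * t))" for t
  define B where "B t = (\<Sum>l\<in>R. \<bar>l - m\<bar> * norm (c l) * exp (- \<bar>l - m\<bar> * t))" for t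
  have lim: "(A \<longlongrightarrow> 0) at_top" "(B \<longlongrightarrow> 0) at_top"
    unfolding A_def[abs_def] B_def[abs_def]
    by (intro tendsto_null_sum tendsto_mult_right_zero tendsto_exp_neg_mult_at_top; simp add: R_def)+
  \<comment> \<open>These thresholds keep the denominator \<open>c m + P\<close> at least
    \<open>norm (c m) / 2\<close> in norm and make the error quotient at most
    \<open>\<epsilon>\<close>.\<close>
  have "0 < norm (c m) / 2" "0 < \<epsilon> * norm (c m) / 2"
    using assms by auto
  then have "\<forall>\<^sub>F t in at_top. A t < norm (c m) / 2" "\<forall>\<^sub>F t in at_top. B t < \<epsilon> * norm (c m) / 2"
    using lim by (blast intro: order_tendstoD(2))+
  then show ?thesis
  proof eventually_elim
    case (elim T)
    show ?case
    proof (intro allI impI)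
      fix z assume z: "\<sigma> * Im z = T"
      define P where "P = (\<Sum>l\<in>R. c l * exp (\<i> * (l - m) * z))"
      define Q where "Q = (\<Sum>l\<in>R. \<i> * (l - m) * c l * exp (\<i> * (l - m) * z))"
      have e: "norm (exp (\<i> * (l - m) * z)) = exp (- \<bar>l - m\<bar> * T)" if "l \<in> R" for l
        using pos[of l] that \<sigma> z by (auto simp: R_def algebra_simps)
      have P: "norm P \<le> A T" unfolding P_def A_def
        by (rule sum_norm_le) (simp add: norm_mult e del: of_real_diff norm_exp_eq_Re)
      have Q: "norm Q \<le> B T" unfolding Q_def B_def
        by (rule sum_norm_le) (simp add: norm_mult e del: of_real_diff norm_exp_eq_Re)
      have ins: "K = insert m R" "m \<notin> R" "finite R" using assms by (auto simp: R_def)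
      have g: "exp_sum K c z = exp (\<i> * m * z) * (c m + P)"
        using ins by (simp add: exp_sum_def P_def algebra_simps sum_distrib_left flip: exp_add)
      have "deriv (exp_sum K c) z - \<i> * m * exp_sum K c z = exp (\<i> * m * z) * Q"
        using ins unfolding deriv_exp_sum
        by (simp add: exp_sum_def Q_def algebra_simps sum_distrib_left sum_subtractf flip: exp_add)
      then have diff: "deriv (exp_sum K c) z = exp (\<i> * m * z) * Q + \<i> * m * exp_sum K c z"
        by (simp add: algebra_simps)
      have "norm (c m) > 0" using assms by simp
      have "norm (c m) / 2 \<le> norm (c m + P)"
        using P elim norm_triangle_ineq2[of "c m" "- P"] by simp
      then have nz: "c m + P \<noteq> 0" using \<open>norm (c m) > 0\<close> by auto
      then have g': "deriv (exp_sum K c) z / exp_sum K c z - \<i> * m = Q / (c m + P)"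
        unfolding diff by (simp add: g add_divide_distrib)
      have "norm (Q / (c m + P)) \<le> (\<epsilon> * norm (c m) / 2) / (norm (c m) / 2)"
        unfolding norm_divide
        using Q elim \<open>\<epsilon> > 0\<close> \<open>norm (c m) / 2 \<le> norm (c m + P)\<close> \<open>norm (c m) > 0\<close>
        by (intro frac_le) auto
      then show "exp_sum K c z \<noteq> 0 \<and> norm (deriv (exp_sum K c) z / exp_sum K c z - \<i> * m) \<le> \<epsilon>"
        using nz g g' \<open>norm (c m) > 0\<close> by simp
    qed
  qed
qed

lemma contour_integral_linepath_near_const:
  assumes cont: "continuous_on (closed_segment u v) f" and "0 \<le> \<epsilon>"
    and "\<And>z. z \<in> closed_segment u v \<Longrightarrow> norm (f z - w) \<le> \<epsilon>"
  shows "norm (contour_integral (linepath u v) f - w * (v - u)) \<le> \<epsilon> * norm (v - u)"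
proof (rule has_contour_integral_bound_linepath[where f = "\<lambda>z. f z - w"])
  show "((\<lambda>z. f z - w) has_contour_integral contour_integral (linepath u v) f - w * (v - u)) (linepath u v)"
    by (intro has_contour_integral_diff has_contour_integral_const_linepath
        has_contour_integral_integral contour_integrable_continuous_linepath cont)
qed (use assms in auto)

section \<open>Langer's bound for the number of real zeros\<close>

text \<open>The horizontal sides of the rectangle together contribute less than
  \<open>2 * pi\<close> and each vertical side at most \<open>pi * (card K - 1)\<close>, so the
  total change of argument stays below \<open>2 * pi * card K\<close>.\<close>

lemma card_real_zeros_exp_sum:
  fixes p q :: real
  assumes K: "finite K" "K \<noteq> {}" and c: "\<And>l. l \<in> K \<Longrightarrow> c l \<noteq> 0"
    and Z: "finite Z" "Z \<subseteq> {p..q}" "\<And>s. s \<in> Z \<Longrightarrow> exp_sum K c (of_real s) = 0"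
    and "p \<le> q" and gap: "(Max K - Min K) * (q - p) < 2 * pi"
  shows "card Z < card K"
proof -
  let ?g = "exp_sum K c"
  let ?f = "\<lambda>z. deriv ?g z / ?g z"
  define L where "L = Max K - Min K"
  have "L \<ge> 0" using K by (simp add: L_def)
  \<comment> \<open>The margin by which the rectangle may exceed \<open>{p..q}\<close> on either
    side while \<open>L * d < 2 * pi\<close> persists. The \<open>L + 1\<close> avoids division by
    zero for a single frequency.\<close>
  define \<eta> where "\<eta> = min (1/2) ((2 * pi - L * (q - p)) / (4 * (L + 1)))"
  have \<eta>: "\<eta> > 0" "\<eta> < 1" using gap \<open>L \<ge> 0\<close> by (auto simp: \<eta>_def L_def)
  define d where "d = q - p + 2 * \<eta>"
  have "d > 0" using \<eta> \<open>p \<le> q\<close> by (simp add: d_def)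
  have Ld: "L * d < 2 * pi"
  proof -
    have "\<eta> * (4 * (L + 1)) \<le> 2 * pi - L * (q - p)"
      using \<open>L \<ge> 0\<close> by (simp add: \<eta>_def flip: pos_le_divide_eq)
    moreover have "L * (2 * \<eta>) < \<eta> * (4 * (L + 1))"
      using \<open>L \<ge> 0\<close> \<eta> by (simp add: algebra_simps add_pos_nonneg)
    ultimately show ?thesis by (simp add: d_def algebra_simps)
  qed
  \<comment> \<open>The errors on the two horizontal sides then use up only half of the slack
    \<open>2 * pi - L * d\<close>.\<close>
  define \<epsilon> where "\<epsilon> = (2 * pi - L * d) / (4 * d)"
  have \<epsilon>: "\<epsilon> > 0" "L * d + 2 * (\<epsilon> * d) < 2 * pi"
    using Ld \<open>d > 0\<close> by (auto simp: \<epsilon>_def field_simps)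
  have "\<forall>\<^sub>F T in at_top. T > 0
      \<and> (\<forall>z. 1 * Im z = T \<longrightarrow> ?g z \<noteq> 0 \<and> norm (?f z - \<i> * Min K) \<le> \<epsilon>)
      \<and> (\<forall>z. - 1 * Im z = T \<longrightarrow> ?g z \<noteq> 0 \<and> norm (?f z - \<i> * Max K) \<le> \<epsilon>)"
    using K c \<epsilon>
    by (intro eventually_conj eventually_gt_at_top exp_sum_log_deriv_limit)
      (auto simp: order_less_le)
  then obtain T where T: "T > 0"
    "\<And>z. Im z = T \<Longrightarrow> ?g z \<noteq> 0 \<and> norm (?f z - \<i> * Min K) \<le> \<epsilon>"
    "\<And>z. Im z = - T \<Longrightarrow> ?g z \<noteq> 0 \<and> norm (?f z - \<i> * Max K) \<le> \<epsilon>"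
    by (auto dest!: eventually_happens)
  \<comment> \<open>An open neighbourhood of the rectangle, as the argument principle requires.
    Being bounded, it contains finitely many zeros.\<close>
  define B where "B = box (Complex (p - 1) (- T - 1)) (Complex (q + 1) (T + 1))"
  define P where "P = {w\<in>B. ?g w = 0}"
  have "finite {z\<in>closure B. ?g z = 0}"
  proof (cases "?g constant_on UNIV")
    case True
    then have "?g z \<noteq> 0" for z
      using T(2)[of "\<i> * T"] by (auto simp: constant_on_def)
    then show ?thesis by simp
  next
    case False
    have "compact (closure B)" by (simp add: B_def bounded_box)
    then show ?thesis
      using False by (intro holomorphic_compact_finite_zeros[of _ UNIV]) (auto intro: holomorphic_intros)
  qed
  then have "finite P"
    by (rule rev_finite_subset) (use closure_subset in \<open>auto simp: P_def\<close>)
  \<comment> \<open>The vertical sides must avoid the zeros, which excludes only finitely many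
    abscissas.\<close>
  have "\<exists>t\<in>{x<..<y}. t \<notin> Re ` P" if "x < y" for x y :: real
    using infinite_Ioo[OF that] \<open>finite P\<close> by (meson finite_imageI finite_subset subsetI)
  from this[of "p - \<eta>" p] this[of q "q + \<eta>"] \<eta>
  obtain \<alpha> \<beta> where \<alpha>: "p - \<eta> < \<alpha>" "\<alpha> < p" "\<alpha> \<notin> Re ` P" and \<beta>: "q < \<beta>" "\<beta> < q + \<eta>" "\<beta> \<notin> Re ` P"
    by auto
  have \<alpha>\<beta>: "\<alpha> < \<beta>" "\<beta> - \<alpha> \<le> d" using \<alpha> \<beta> \<open>p \<le> q\<close> by (auto simp: d_def)
  define a1 a2 a3 a4 where a_defs: "a1 = Complex \<alpha> (- T)" "a2 = Complex \<beta> (- T)" "a3 = Complex \<beta> T" "a4 = Complex \<alpha> T"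
  have sub: "cbox a1 a3 \<subseteq> B"
    using \<alpha> \<beta> T(1) \<eta> by (auto simp: a_defs B_def in_cbox_complex_iff in_box_complex_iff)
  have le: "Re a1 \<le> Re a3" "Im a1 \<le> Im a3"
    using \<alpha>\<beta> T(1) by (simp_all add: a_defs)
  have nzpath: "?g z \<noteq> 0" if "z \<in> path_image (rectpath a1 a3)" for z
  proof -
    have "z \<in> B" using that path_image_rectpath_subset_cbox[OF le] sub by blast
    moreover have "Im z \<in> {T, - T} \<or> Re z \<in> {\<alpha>, \<beta>}"
      using that unfolding path_image_rectpath[OF le] by (auto simp: a_defs)
    ultimately show ?thesis
      using T(2,3) \<alpha>(3) \<beta>(3) by (auto simp: P_def)
  qed
  have segs: "path_image (rectpath a1 a3) =
      closed_segment a1 a2 \<union> closed_segment a2 a3 \<union> closed_segment a3 a4 \<union> closed_segment a4 a1"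
    by (simp add: rectpath_def Let_def path_image_join Un_assoc a_defs)
  define I1 I2 I3 I4 where I_defs: "I1 = contour_integral (linepath a1 a2) ?f"
    "I2 = contour_integral (linepath a2 a3) ?f" "I3 = contour_integral (linepath a3 a4) ?f"
    "I4 = contour_integral (linepath a4 a1) ?f"
  have cont: "continuous_on (path_image (rectpath a1 a3)) ?f"
    by (rule continuous_on_log_deriv_exp_sum[OF nzpath])
  have conts: "continuous_on (closed_segment a1 a2) ?f" "continuous_on (closed_segment a2 a3) ?f"
    "continuous_on (closed_segment a3 a4) ?f" "continuous_on (closed_segment a4 a1) ?f"
    using segs by (auto intro: continuous_on_subset[OF cont])
  have "(?f has_contour_integral I1 + (I2 + (I3 + I4)))
      (linepath a1 a2 +++ linepath a2 a3 +++ linepath a3 a4 +++ linepath a4 a1)"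
    unfolding I_defs
    by (intro has_contour_integral_join has_contour_integral_integral
        contour_integrable_continuous_linepath conts) auto
  then have sum4: "contour_integral (rectpath a1 a3) ?f = I1 + (I2 + (I3 + I4))"
    by (intro contour_integral_unique) (simp add: rectpath_def Let_def a_defs)
  have lens: "norm (a2 - a1) = \<beta> - \<alpha>" "norm (a4 - a3) = \<beta> - \<alpha>"
    using \<alpha>\<beta> by (simp_all add: a_defs cmod_def)
  \<comment> \<open>The boundary runs counterclockwise from the lower left corner: the bottom side
    goes right and picks up \<open>Max K\<close>, the top side goes left and picks up
    \<open>- Min K\<close>.\<close>
  have "norm (I1 - \<i> * Max K * (a2 - a1)) \<le> \<epsilon> * norm (a2 - a1)"
    unfolding I_defs using T(3) \<epsilon>
    by (intro contour_integral_linepath_near_const conts) (auto simp: a_defs closed_segment_same_Im)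
  then have I1: "Im I1 \<le> Max K * (\<beta> - \<alpha>) + \<epsilon> * (\<beta> - \<alpha>)"
    using abs_Im_le_cmod[of "I1 - \<i> * Max K * (a2 - a1)"] unfolding lens
    by (simp add: a_defs)
  have "norm (I3 - \<i> * Min K * (a4 - a3)) \<le> \<epsilon> * norm (a4 - a3)"
    unfolding I_defs using T(2) \<epsilon>
    by (intro contour_integral_linepath_near_const conts) (auto simp: a_defs closed_segment_same_Im)
  then have I3: "Im I3 \<le> - Min K * (\<beta> - \<alpha>) + \<epsilon> * (\<beta> - \<alpha>)"
    using abs_Im_le_cmod[of "I3 - \<i> * Min K * (a4 - a3)"] unfolding lens
    by (simp add: a_defs algebra_simps)
  have "\<bar>Im I2\<bar> \<le> pi * (real (card K) - 1)" "\<bar>Im I4\<bar> \<le> pi * (real (card K) - 1)"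
    unfolding I_defs using T(1) segs nzpath
    by (intro exp_sum_arg_change_vertical K; force simp: a_defs)+
  moreover have "L * (\<beta> - \<alpha>) \<le> L * d" "\<epsilon> * (\<beta> - \<alpha>) \<le> \<epsilon> * d"
    using \<alpha>\<beta> \<open>L \<ge> 0\<close> \<epsilon> by (auto intro: mult_left_mono)
  moreover have "Max K * (\<beta> - \<alpha>) - Min K * (\<beta> - \<alpha>) = L * (\<beta> - \<alpha>)"
    by (simp add: L_def algebra_simps)
  ultimately have upper: "Im (I1 + (I2 + (I3 + I4))) < 2 * pi * card K"
    using I1 I3 \<epsilon> by (simp add: algebra_simps)
  let ?r = "rectpath a1 a3"
  \<comment> \<open>The argument principle with weight function 1 and empty set of poles.\<close>
  have argp: "contour_integral ?r (\<lambda>z. deriv ?g z * 1 / ?g z) =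
      2 * pi * \<i> * (\<Sum>w\<in>{w\<in>B. ?g w = 0 \<or> w \<in> {}}. winding_number ?r w * 1 * zorder ?g w)"
  proof (rule argument_principle)
    show "open B" "connected B" by (auto simp: B_def intro: convex_connected)
    show "path_image ?r \<subseteq> B - {w\<in>B. ?g w = 0 \<or> w \<in> {}}"
      using nzpath path_image_rectpath_subset_cbox[OF le] sub by blast
    show "\<forall>z. z \<notin> B \<longrightarrow> winding_number ?r z = 0"
      using sub winding_number_rectpath_outside[OF le] by blast
    show "finite {w\<in>B. ?g w = 0 \<or> w \<in> {}}" using \<open>finite P\<close> by (simp add: P_def)
  qed (auto intro: holomorphic_intros simp: rectpath_def Let_def intro!: valid_path_join)
  \<comment> \<open>Zeros inside the rectangle have winding number 1, those outside have 0, and none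
    lies on the boundary.\<close>
  define Q where "Q = P \<inter> box a1 a3"
  have "(\<Sum>w\<in>P. winding_number ?r w * zorder ?g w) = (\<Sum>w\<in>Q. of_int (zorder ?g w))"
  proof (rule sum.mono_neutral_cong_right)
    show "\<forall>w\<in>P - Q. winding_number ?r w * zorder ?g w = 0"
    proof
      fix w assume w: "w \<in> P - Q"
      then have "w \<notin> path_image ?r" using nzpath by (auto simp: P_def)
      with w have "w \<notin> cbox a1 a3"
        by (auto simp: Q_def path_image_rectpath_cbox_minus_box[OF le])
      then show "winding_number ?r w * zorder ?g w = 0"
        using winding_number_rectpath_outside[OF le] by simp
    qed
  qed (auto simp: Q_def \<open>finite P\<close> winding_number_rectpath)
  then have int: "I1 + (I2 + (I3 + I4)) = 2 * pi * \<i> * of_int (\<Sum>w\<in>Q. zorder ?g w)"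
    using argp sum4 by (simp add: P_def)
  have "card Z = card ((of_real :: real \<Rightarrow> complex) ` Z)"
    by (simp add: card_image inj_on_def)
  also have "\<dots> \<le> card Q"
  proof (rule card_mono)
    show "finite Q" using \<open>finite P\<close> by (simp add: Q_def)
    show "of_real ` Z \<subseteq> Q"
      using Z(2,3) \<alpha> \<beta> T(1) \<eta> sub
      by (force simp: Q_def P_def B_def a_defs in_box_complex_iff)
  qed
  finally have "int (card Z) \<le> int (card Q)" by simp
  also have "\<dots> = (\<Sum>w\<in>Q. 1)" by simp
  \<comment> \<open>Since the sum does not vanish identically, every zero has order at least 1;
    multiplicities only help.\<close>
  also have "\<dots> \<le> (\<Sum>w\<in>Q. zorder ?g w)"
  proof (rule sum_mono)
    fix w assume "w \<in> Q"
    then have "?g w = 0" by (simp add: Q_def P_def)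
    moreover have "\<exists>z\<in>UNIV. ?g z \<noteq> 0" using T(2)[of "\<i> * T"] by auto
    ultimately show "1 \<le> zorder ?g w"
      using zorder_exist_zero[OF holomorphic_exp_sum open_UNIV connected_UNIV UNIV_I, of K c w] by simp
  qed
  finally have "2 * pi * card Z \<le> 2 * pi * of_int (\<Sum>w\<in>Q. zorder ?g w)"
    by (intro mult_left_mono) (metis of_int_le_iff of_int_of_nat_eq, simp)
  also have "\<dots> = Im (I1 + (I2 + (I3 + I4)))"
    unfolding int by simp
  also note upper
  finally show ?thesis by simp
qed

section \<open>Fourier transforms of shifted signals\<close>

lemma integral_lebesgue_shift:
  fixes f :: "real \<Rightarrow> 'a::{banach, second_countable_topology}"
  assumes [measurable]: "f \<in> borel_measurable lebesgue"
  shows "(LINT t|lebesgue. f (c + t)) = (LINT t|lebesgue. f t)"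
    and "integrable lebesgue (\<lambda>t. f (c + t)) \<longleftrightarrow> integrable lebesgue f"
proof -
  have m [measurable]: "(\<lambda>t. c + t) \<in> lebesgue \<rightarrow>\<^sub>M lebesgue"
    using lebesgue_affine_measurable[of "\<lambda>_::real. 1" c] by simp
  have "(lebesgue :: real measure) = distr lebesgue lebesgue (\<lambda>t. c + t)"
    using lebesgue_real_affine[of 1 c] by (simp add: density_1)
  then show "(LINT t|lebesgue. f (c + t)) = (LINT t|lebesgue. f t)"
    and "integrable lebesgue (\<lambda>t. f (c + t)) \<longleftrightarrow> integrable lebesgue f"
    using integral_distr[OF m assms] integrable_distr_eq[OF m assms] by simp_all
qed

lemma integrable_fourier_integrand:
  fixes g :: "real \<Rightarrow> real" and s :: real
  assumes "integrable lebesgue g"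
  shows "integrable lebesgue (\<lambda>x. exp (- 2 * pi * \<i> * s * x) * complex_of_real (g x))"
proof (rule Bochner_Integration.integrable_bound)
  show "integrable lebesgue g" by fact
  have "(\<lambda>x::real. exp (- 2 * pi * \<i> * s * x)) \<in> borel_measurable lebesgue"
    by (intro continuous_imp_measurable_on_sets_lebesgue[of UNIV, simplified lebesgue_on_UNIV_eq] continuous_intros) simp_all
  moreover have "(\<lambda>x. complex_of_real (g x)) \<in> borel_measurable lebesgue"
    by (rule borel_measurable_integrable[OF integrable_of_real[OF assms]])
  ultimately show "(\<lambda>x. exp (- 2 * pi * \<i> * s * x) * complex_of_real (g x)) \<in> borel_measurable lebesgue"
    by (rule borel_measurable_times)
  show "AE x in lebesgue. norm (exp (- 2 * pi * \<i> * s * x) * complex_of_real (g x)) \<le> norm (g x)"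
    by (simp add: norm_mult)
qed

lemma fourier_shift:
  assumes "integrable lebesgue g"
  shows "fourier (\<lambda>t. g (t - c)) s = ypow c s * fourier g s"
proof -
  \<comment> \<open>The integrand after the substitution that centres the signal; translating it
    back by \<open>- c\<close> restores the original one.\<close>
  let ?h = "\<lambda>t::real. exp (- 2 * pi * \<i> * s * (c + t)) * complex_of_real (g t)"
  have eq: "?h = (\<lambda>t. ypow c s * (exp (- 2 * pi * \<i> * s * t) * complex_of_real (g t)))"
    by (rule ext) (simp add: ypow_def algebra_simps flip: exp_add)
  have int: "integrable lebesgue ?h"
    unfolding eq by (intro integrable_mult_right integrable_fourier_integrand assms)
  have "fourier (\<lambda>t. g (t - c)) s = (LINT t|lebesgue. ?h (- c + t))"
    by (simp add: fourier_def)
  also have "\<dots> = (LINT t|lebesgue. ?h t)"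
    using int by (intro integral_lebesgue_shift) (rule borel_measurable_integrable)
  also have "\<dots> = ypow c s * fourier g s"
    unfolding eq fourier_def by simp
  finally show ?thesis .
qed

lemma integrable_shift:
  fixes g :: "real \<Rightarrow> real"
  assumes "integrable lebesgue g"
  shows "integrable lebesgue (\<lambda>t. g (t - c))"
  using integral_lebesgue_shift(2)[of g "- c"] assms by (simp add: borel_measurable_integrable)

lemma fourier_sum:
  assumes "\<And>i. i \<in> I \<Longrightarrow> integrable lebesgue (g i)"
  shows "fourier (\<lambda>t. \<Sum>i\<in>I. g i t) s = (\<Sum>i\<in>I. fourier (g i) s)"
  unfolding fourier_def of_real_sum sum_distrib_left
  by (intro Bochner_Integration.integral_sum integrable_fourier_integrand assms)

lemma fourier_cmult: "fourier (\<lambda>t. r * g t) s = r * fourier g s"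
  by (simp add: fourier_def mult.left_commute)

text \<open>Where all transforms but one vanish, a single product remains, and dividing by its
  transform gives an equation of the system.\<close>

lemma fourier_shift_combination:
  assumes "\<And>j. j \<in> J \<Longrightarrow> integrable lebesgue (f j)"
  shows "fourier (\<lambda>t. \<Sum>j\<in>J. \<Sum>q\<in>I. a j q * f j (t - x j q)) s
       = (\<Sum>j\<in>J. (\<Sum>q\<in>I. a j q * ypow (x j q) s) * fourier (f j) s)"
  using assms
  by (simp add: fourier_sum fourier_cmult fourier_shift integrable_shift sum_distrib_right mult.assoc)

section \<open>Uniqueness of shifts and amplitudes\<close>

text \<open>Langer's bound for the frequencies \<open>- 2 * pi * t\<close>: a nontrivial combination
  would have fewer zeros than terms.\<close>

lemma ypow_sum_unique:
  fixes S :: "real set" and c :: "real \<Rightarrow> complex"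
  assumes "finite S" "finite X" "card X \<le> card S"
    and S: "S \<subseteq> {p..q}" and X: "\<And>t u. t \<in> X \<Longrightarrow> u \<in> X \<Longrightarrow> (t - u) * (q - p) < 1"
    and zero: "\<And>s. s \<in> S \<Longrightarrow> (\<Sum>t\<in>X. c t * ypow t s) = 0"
  shows "\<forall>t\<in>X. c t = 0"
proof (rule ccontr)
  assume contra: "\<not> ?thesis"
  define h where "h t = - 2 * pi * t" for t :: real
  \<comment> \<open>The bound concerns sums with nonzero coefficients, so the vanishing ones are
    discarded first.\<close>
  define Y where "Y = {t\<in>X. c t \<noteq> 0}"
  have Y: "finite Y" "Y \<noteq> {}" "Y \<subseteq> X" using contra \<open>finite X\<close> by (auto simp: Y_def)
  have "inj h" by (auto simp: h_def inj_on_def)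
  have "card Y > 0" using Y by (simp add: card_gt_0_iff)
  then have "card S > 0" using card_mono[OF \<open>finite X\<close> Y(3)] \<open>card X \<le> card S\<close> by linarith
  then have "p \<le> q" using S by (fastforce simp: card_gt_0_iff)
  have "card S < card (h ` Y)"
  proof (rule card_real_zeros_exp_sum[of _ "\<lambda>l. c (- l / (2 * pi))", OF _ _ _ \<open>finite S\<close> S _ \<open>p \<le> q\<close>])
    show "finite (h ` Y)" "h ` Y \<noteq> {}" using Y by auto
    show "c (- l / (2 * pi)) \<noteq> 0" if "l \<in> h ` Y" for l
      using that by (auto simp: h_def Y_def)
    show "exp_sum (h ` Y) (\<lambda>l. c (- l / (2 * pi))) (of_real s) = 0" if "s \<in> S" for s
    proof -
      have "exp_sum (h ` Y) (\<lambda>l. c (- l / (2 * pi))) (of_real s) = (\<Sum>t\<in>Y. c t * ypow t s)"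
        unfolding exp_sum_def using \<open>inj h\<close>
        by (subst sum.reindex) (auto intro: inj_on_subset simp: h_def ypow_def mult_ac)
      also have "\<dots> = (\<Sum>t\<in>X. c t * ypow t s)"
        using \<open>finite X\<close> by (intro sum.mono_neutral_left) (auto simp: Y_def)
      finally show ?thesis using zero[OF that] by simp
    qed
    have "Max (h ` Y) \<in> h ` Y" "Min (h ` Y) \<in> h ` Y"
      using Y by (auto intro!: Max_in Min_in simp del: Max_in Min_in)
    then obtain t u where tu: "t \<in> Y" "u \<in> Y" "Max (h ` Y) = h t" "Min (h ` Y) = h u"
      by (metis imageE)
    \<comment> \<open>The map \<open>h\<close> reverses the order, so the largest frequency belongs
      to the smallest shift.\<close>
    then have "(Max (h ` Y) - Min (h ` Y)) * (q - p) = 2 * pi * ((u - t) * (q - p))"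
      by (simp add: h_def algebra_simps)
    also have "\<dots> < 2 * pi * 1"
      using X[of u t] tu Y by (intro mult_strict_left_mono) auto
    finally show "(Max (h ` Y) - Min (h ` Y)) * (q - p) < 2 * pi" by simp
  qed
  also have "card (h ` Y) \<le> card X"
    using card_mono[OF \<open>finite X\<close> Y(3)] card_image_le[OF Y(1), of h] by linarith
  finally show False using \<open>card X \<le> card S\<close> by simp
qed

text \<open>Collecting terms by their shift merges coinciding shifts into one coefficient, which
  makes the frequencies distinct.\<close>

lemma sum_fibres:
  fixes g :: "'a \<Rightarrow> 'c::comm_ring_1" and x :: "'b \<Rightarrow> 'a" and a :: "'b \<Rightarrow> 'c"
  assumes "finite I" "finite X" "x ` I \<subseteq> X"
  shows "(\<Sum>q\<in>I. a q * g (x q)) = (\<Sum>t\<in>X. (\<Sum>q\<in>{q\<in>I. x q = t}. a q) * g t)"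
  using sum.group[OF assms, of "\<lambda>q. a q * g (x q)"] by (simp add: sum_distrib_right)

text \<open>The first solution has nonzero mass at \<open>N\<close> distinct points. The
  \<open>N\<close> terms of the second must reach all of them, hence exactly one term sits at each
  point and carries its whole mass.\<close>

lemma same_up_to_order_if_nondegenerate:
  assumes nd: "nondegenerate N a x" and same: "same_combination N a x a' x'"
  shows "same_up_to_order N a x a' x'"
proof -
  define I where "I = {1..N}"
  have I: "finite I" "card I = N" by (simp_all add: I_def)
  have inj: "inj_on x I" and nz: "\<And>q. q \<in> I \<Longrightarrow> a q \<noteq> 0"
    using nd by (auto simp: nondegenerate_def I_def)
  have fib: "(\<Sum>q\<in>{q\<in>I. x q = t}. a q) = (\<Sum>q\<in>{q\<in>I. x' q = t}. a' q)" for t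
    using same by (simp add: same_combination_def I_def)
  have xfib: "{r\<in>I. x r = x q} = {q}" if "q \<in> I" for q
    using inj that by (auto dest: inj_onD)
  have sub: "x ` I \<subseteq> x' ` I"
  proof
    fix t assume "t \<in> x ` I"
    then obtain q where q: "q \<in> I" "t = x q" by auto
    then have "(\<Sum>r\<in>{r\<in>I. x' r = t}. a' r) \<noteq> 0"
      using fib[of t] xfib[OF q(1)] nz[OF q(1)] by simp
    then have "{r\<in>I. x' r = t} \<noteq> {}" by (metis sum.empty)
    then show "t \<in> x' ` I" by auto
  qed
  have "card (x ` I) = N" using inj I by (simp add: card_image)
  moreover have "card (x' ` I) \<le> N" using card_image_le[of I x'] I by simp
  ultimately have eq: "x ` I = x' ` I"
    using card_subset_eq[OF _ sub] card_mono[OF _ sub] I by simp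
  then have inj': "inj_on x' I"
    using \<open>card (x ` I) = N\<close> I eq by (intro eq_card_imp_inj_on) auto
  define p where "p q = the_inv_into I x (x' q)" for q
  have bij: "bij_betw p I I"
    using bij_betw_trans[OF inj_on_imp_bij_betw[OF inj'], of "the_inv_into I x" I]
      bij_betw_the_inv_into[OF inj_on_imp_bij_betw[OF inj]] eq
    by (simp add: p_def[abs_def] o_def)
  have "x' q = x (p q) \<and> a' q = a (p q)" if "q \<in> I" for q
  proof -
    have px: "x (p q) = x' q"
      using f_the_inv_into_f[OF inj, of "x' q"] eq that by (auto simp: p_def)
    have pq: "p q \<in> I" using bij that by (auto simp: bij_betw_def)
    have "{r\<in>I. x' r = x' q} = {q}" using inj' that by (auto dest: inj_onD)
    then have "a (p q) = a' q" using fib[of "x' q"] xfib[OF pq] px by simp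
    then show ?thesis using px by simp
  qed
  then show ?thesis using bij by (auto simp: same_up_to_order_def I_def)
qed

text \<open>The difference of two solutions involves at most \<open>2 * N\<close> shifts and
  vanishes at \<open>2 * N\<close> or more samples.\<close>

lemma system_solutions_same_combination:
  assumes S: "finite S" "2 * N \<le> card S" "S \<subseteq> {p..q}" and "\<rho> * (q - p) \<le> 1" "p < q"
    and sol: "system_solution N S R \<rho> a x" "system_solution N S R \<rho> a' x'"
  shows "same_combination N a x a' x'"
proof -
  let ?I = "{1..N}"
  define X where "X = x ` ?I \<union> x' ` ?I"
  define c where "c t = (\<Sum>r\<in>{r\<in>?I. x r = t}. a r) - (\<Sum>r\<in>{r\<in>?I. x' r = t}. a' r)" for t
  have "card X \<le> card S"
    unfolding X_def using S(2) card_Un_le[of "x ` ?I" "x' ` ?I"] card_image_le[of ?I x] card_image_le[of ?I x']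
    by simp
  have "\<forall>t\<in>X. complex_of_real (c t) = 0"
  proof (rule ypow_sum_unique[OF \<open>finite S\<close> _ \<open>card X \<le> card S\<close> \<open>S \<subseteq> {p..q}\<close>])
    show "finite X" by (simp add: X_def)
    fix t u assume "t \<in> X" "u \<in> X"
    moreover have "X \<subseteq> {0..<\<rho>}"
      using sol unfolding X_def system_solution_def by blast
    ultimately have "t \<in> {0..<\<rho>}" "u \<in> {0..<\<rho>}" by blast+
    \<comment> \<open>The half-open range of the shifts makes this strict, and the strictness
      survives to the bound by 1.\<close>
    then have "t - u < \<rho>" by simp
    then have "(t - u) * (q - p) < \<rho> * (q - p)"
      using \<open>p < q\<close> by simp
    then show "(t - u) * (q - p) < 1" using \<open>\<rho> * (q - p) \<le> 1\<close> by linarith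
  next
    fix s assume "s \<in> S"
    have "(\<Sum>r\<in>?I. complex_of_real (a r) * ypow (x r) s) = (\<Sum>r\<in>?I. complex_of_real (a' r) * ypow (x' r) s)"
      using sol \<open>s \<in> S\<close> by (simp add: system_solution_def)
    moreover have "finite X" "x ` ?I \<subseteq> X" "x' ` ?I \<subseteq> X" by (auto simp: X_def)
    ultimately show "(\<Sum>t\<in>X. complex_of_real (c t) * ypow t s) = 0"
      using sum_fibres[of ?I X x "\<lambda>r. complex_of_real (a r)" "\<lambda>t. ypow t s"]
        sum_fibres[of ?I X x' "\<lambda>r. complex_of_real (a' r)" "\<lambda>t. ypow t s"]
      by (simp add: c_def left_diff_distrib sum_subtractf)
  qed
  then have X0: "c t = 0" if "t \<in> X" for t using that by simp
  have "c t = 0" if "t \<notin> X" for t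
  proof -
    have "{r\<in>?I. x r = t} = {}" "{r\<in>?I. x' r = t} = {}" using that by (auto simp: X_def)
    then show ?thesis by (simp only: c_def) simp
  qed
  with X0 have "c t = 0" for t by blast
  then show ?thesis by (simp add: same_combination_def c_def)
qed

section \<open>Sampling intervals and the two systems\<close>

text \<open>The interval contains the segment spanned by the samples. Boundedness supplies the
  finite measure that monotonicity of \<open>measure\<close> requires.\<close>

lemma Max_minus_Min_le_interval_length:
  fixes S \<Delta> :: "real set"
  assumes "bounded_interval \<Delta>" "finite S" "S \<subseteq> \<Delta>" "S \<noteq> {}"
  shows "Max S - Min S \<le> measure lborel \<Delta>"
proof -
  have S: "Max S \<in> \<Delta>" "Min S \<in> \<Delta>" "Min S \<le> Max S"
    using assms(3) Max_in[OF assms(2,4)] Min_in[OF assms(2,4)] Max_ge[OF assms(2)] by auto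
  have \<Delta>: "is_interval \<Delta>" "bounded \<Delta>" using assms by (auto simp: bounded_interval_def)
  have "{Min S..Max S} \<subseteq> \<Delta>"
    by (meson atLeastAtMost_iff mem_is_interval_1_I[OF \<Delta>(1) S(2,1)] subsetI)
  moreover have "\<Delta> \<in> fmeasurable lborel"
  proof -
    have "emeasure lborel \<Delta> < \<infinity>" using \<Delta>(2) by (rule emeasure_bounded_finite)
    moreover have "\<Delta> \<in> sets borel" using \<Delta>(1) by (rule real_interval_borel_measurable)
    ultimately show ?thesis by (simp add: fmeasurable_def)
  qed
  ultimately have "measure lborel {Min S..Max S} \<le> measure lborel \<Delta>"
    by (intro measure_mono_fmeasurable) auto
  then show ?thesis using S by simp
qed

theorem mainTheorem2:
  fixes f :: "nat \<Rightarrow> real \<Rightarrow> real"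
    and F :: "real \<Rightarrow> real"
    and N :: nat
    and a x :: "nat \<Rightarrow> nat \<Rightarrow> real"
    and \<Delta> S :: "nat \<Rightarrow> real set"
    and D \<rho> :: "nat \<Rightarrow> real"
  assumes "N \<ge> 1"
    and "\<And>j. j \<in> {1, 2} \<Longrightarrow> integrable lebesgue (f j)"
    and "\<And>t. F t = (\<Sum>j=1..2. \<Sum>q=1..N. a j q * f j (t - x j q))"
    and "\<And>j. j \<in> {1, 2} \<Longrightarrow> has_at_least (W f j) (2 * N)"
    and "\<And>j. j \<in> {1, 2} \<Longrightarrow> shortest_interval (W f j) (2 * N) (\<Delta> j)"
    and "\<And>j. j \<in> {1, 2} \<Longrightarrow> S j = \<Delta> j \<inter> W f j"
    and "\<And>j. j \<in> {1, 2} \<Longrightarrow> D j = measure lborel (\<Delta> j)"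
    and "\<And>j. j \<in> {1, 2} \<Longrightarrow> \<rho> j = 1 / D j"
    and "\<And>j q. j \<in> {1, 2} \<Longrightarrow> q \<in> {1..N} \<Longrightarrow> x j q \<in> {0..<\<rho> j}"
  shows "\<forall>j\<in>{1, 2}.
    system_solution N (S j) (\<lambda>s. fourier F s / fourier (f j) s) (\<rho> j) (a j) (x j) \<and>
    uniquely_solvable N (S j) (\<lambda>s. fourier F s / fourier (f j) s) (\<rho> j)"
proof
  fix j :: nat assume j: "j \<in> {1, 2}"
  have F: "F = (\<lambda>t. \<Sum>j\<in>{1,2}. \<Sum>q=1..N. a j q * f j (t - x j q))"
    using assms(3) by (simp add: fun_eq_iff numeral_2_eq_2)
  have "(\<Sum>q=1..N. a j q * ypow (x j q) s) = fourier F s / fourier (f j) s" if "s \<in> S j" for s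
  proof -
    have zero: "fourier (f (3 - j)) s = 0" "fourier (f j) s \<noteq> 0"
      using that assms(6)[OF j] by (auto simp: W_def)
    have "fourier F s = (\<Sum>j\<in>{1,2}. (\<Sum>q=1..N. a j q * ypow (x j q) s) * fourier (f j) s)"
      unfolding F by (rule fourier_shift_combination) (rule assms(2))
    also have "\<dots> = (\<Sum>q=1..N. a j q * ypow (x j q) s) * fourier (f j) s"
      \<comment> \<open>At a point of \<open>W f j\<close> the summand of the other signal
        \<open>3 - j\<close> vanishes.\<close>
      using j zero(1) by auto
    finally show ?thesis using zero(2) by simp
  qed
  then have sol: "system_solution N (S j) (\<lambda>s. fourier F s / fourier (f j) s) (\<rho> j) (a j) (x j)"
    using assms(9)[OF j] by (simp add: system_solution_def)
  have \<Delta>: "bounded_interval (\<Delta> j)" and Sj: "finite (S j)" "card (S j) = 2 * N" "S j \<subseteq> \<Delta> j"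
    using assms(5,6)[OF j] by (auto simp: shortest_interval_def has_exactly_def)
  have "S j \<noteq> {}" using Sj \<open>N \<ge> 1\<close> by auto
  define p where "p = Min (S j)"
  define q where "q = Max (S j)"
  have pq: "S j \<subseteq> {p..q}" using Sj by (auto simp: p_def q_def)
  \<comment> \<open>There are at least two samples. With \<open>q - p \<le> D j\<close> below, this
    makes \<open>D j\<close> positive, so \<open>\<rho> j\<close> is a true reciprocal and not the
    default value of \<open>1 / 0\<close>.\<close>
  have "p < q"
  proof (rule ccontr)
    assume "\<not> p < q"
    then have "S j \<subseteq> {p}" using pq by auto
    then have "card (S j) \<le> 1" using card_mono[of "{p}" "S j"] by simp
    then show False using Sj \<open>N \<ge> 1\<close> by simp
  qed
  have "q - p \<le> D j"
    unfolding p_def q_def assms(7)[OF j]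
    by (rule Max_minus_Min_le_interval_length) (fact \<Delta> Sj \<open>S j \<noteq> {}\<close>)+
  then have "\<rho> j * (q - p) \<le> 1" using \<open>p < q\<close> by (simp add: assms(8)[OF j])
  then have "same_combination N b y b' y'"
    if "system_solution N (S j) R (\<rho> j) b y" "system_solution N (S j) R (\<rho> j) b' y'" for R b y b' y'
    using system_solutions_same_combination[OF Sj(1) _ pq _ \<open>p < q\<close> that] Sj by simp
  then have "uniquely_solvable N (S j) (\<lambda>s. fourier F s / fourier (f j) s) (\<rho> j)"
    unfolding uniquely_solvable_def using sol same_up_to_order_if_nondegenerate by blast
  with sol show "system_solution N (S j) (\<lambda>s. fourier F s / fourier (f j) s) (\<rho> j) (a j) (x j) \<and>
    uniquely_solvable N (S j) (\<lambda>s. fourier F s / fourier (f j) s) (\<rho> j)" ..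
qed

end
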